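(* Let $L, R$ be inverse-closed subsets of a group $G$ (that is, $L=L^{-1}$ and $R=R^{-1}$) such that $(L,R)$ has the $2$S-Cayley property, and let $\Gamma=\mathrm{2SCay}(G;L,R)$. Then $\Gamma$ is connected if and only if the following condition holds: $( * )$ $G=\langle L\rangle\,\langle R\rangle$, and there exist words $w$ in $L$ and $w'$ in $R$, with lengths of opposite parity, such that $ww'=e$ in $G$. Further, if $G=\langle L\rangle\,\langle R\rangle$ but condition $( * )$ does not hold, then $\Gamma$ is disconnected with exactly two connected components.
   Context: Let $G$ be a group with identity $e$; for $X\subseteq G$ and $g\in G$ write $X^{-1}=\{x^{-1}: x\in X\}$, $X^g=g^{-1}Xg$, and $XY=\{xy: x\in X, y\in Y\}$; $\langle X\rangle$ is the subgroup generated by $X$. For non-empty subsets $L,R$ of $G$, the two-sided Cayley graph $\mathrm{2SCay}(G;L,R)$ is the directed graph with vertex set $G$ with an arc from $x$ to $y$ if and only if $y=\ell^{-1}xr$ for some $\ell\in L$, $r\in R$. If the adjacency relation is symmetric, it is regarded as an undirected graph. A pair $(L,R)$ of subsets of $G$ has the $2$S-Cayley property if both $L,R$ are non-empty and: (1) $L^{-1}gR=LgR^{-1}$ for each $g\in G$ (this makes the adjacency relation symmetric); (2) $L^g\cap R=\varnothing$ for each $g\in G$; (3) $(LL^{-1})^g\cap (RR^{-1})=\{e\}$ for each $g\in G$. A word in a subset $L$ of $G$ is a string $w=\ell_1\ell_2\dots\ell_k$ with each $\ell_i\in L$; the integer $k$ is its length, and $w$ is identified with its evaluation in $G$ (the product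 of the $\ell_i$ in the given order). *)

theory Defs
  imports "HOL-Algebra.Generated_Groups" "Graph_Theory.Graph_Theory"
begin

definition set_conj :: "('a, 'b) monoid_scheme \<Rightarrow> 'a set \<Rightarrow> 'a \<Rightarrow> 'a set" where
  "set_conj G X g = inv\<^bsub>G\<^esub> g <#\<^bsub>G\<^esub> (X #>\<^bsub>G\<^esub> g)"

definition two_S_Cayley_property ::
  "('a, 'b) monoid_scheme \<Rightarrow> 'a set \<Rightarrow> 'a set \<Rightarrow> bool" where
  "two_S_Cayley_property G L R \<longleftrightarrow>
     L \<subseteq> carrier G \<and> R \<subseteq> carrier G \<and> L \<noteq> {} \<and> R \<noteq> {} \<and>
     (\<forall>g\<in>carrier G. (set_inv\<^bsub>G\<^esub> L #>\<^bsub>G\<^esub> g) <#>\<^bsub>G\<^esub> R = (L #>\<^bsub>G\<^esub> g) <#>\<^bsub>G\<^esub> set_inv\<^bsub>G\<^esub> R) \<and>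
     (\<forall>g\<in>carrier G. set_conj G L g \<inter> R = {}) \<and>
     (\<forall>g\<in>carrier G.
        set_conj G (L <#>\<^bsub>G\<^esub> set_inv\<^bsub>G\<^esub> L) g \<inter> (R <#>\<^bsub>G\<^esub> set_inv\<^bsub>G\<^esub> R) = {\<one>\<^bsub>G\<^esub>})"

text \<open>The vertex set may be infinite. An undirected graph is represented, as in the
  library, by a symmetric digraph.\<close>

definition two_S_Cay ::
  "('a, 'b) monoid_scheme \<Rightarrow> 'a set \<Rightarrow> 'a set \<Rightarrow> ('a, 'a \<times> 'a) pre_digraph" where
  "two_S_Cay G L R = with_proj
     \<lparr> pverts = carrier G,
       parcs = {(x, y). x \<in> carrier G \<and> y \<in> carrier G \<and>
         (\<exists>l\<in>L. \<exists>r\<in>R. y = inv\<^bsub>G\<^esub> l \<otimes>\<^bsub>G\<^esub> x \<otimes>\<^bsub>G\<^esub> r)} \<rparr>"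

definition connected_components :: "('a, 'b) pre_digraph \<Rightarrow> ('a, 'b) pre_digraph set" where
  "connected_components \<Gamma> = {H. pre_digraph.max_subgraph \<Gamma> Digraph_Component.connected H}"

text \<open>A word in \<open>X\<close> is an element of \<open>lists X\<close>; the empty word is allowed and evaluates to
  the identity.\<close>

definition word_eval :: "('a, 'b) monoid_scheme \<Rightarrow> 'a list \<Rightarrow> 'a" where
  "word_eval G w = foldr (\<otimes>\<^bsub>G\<^esub>) w \<one>\<^bsub>G\<^esub>"

definition condition_star :: "('a, 'b) monoid_scheme \<Rightarrow> 'a set \<Rightarrow> 'a set \<Rightarrow> bool" where
  "condition_star G L R \<longleftrightarrow>
     carrier G = generate G L <#>\<^bsub>G\<^esub> generate G R \<and>
     (\<exists>w\<in>lists L. \<exists>w'\<in>lists R. even (length w) \<noteq> even (length w') \<and>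
        word_eval G w \<otimes>\<^bsub>G\<^esub> word_eval G w' = \<one>\<^bsub>G\<^esub>)"

end

theory Submission
  imports Defs
begin

text \<open>
  Since \<open>L\<close> and \<open>R\<close> are inverse-closed, a walk of length \<open>k\<close> from \<open>x\<close> ends at \<open>u x v\<close>, where
  \<open>u\<close> is a word in \<open>L\<close> and \<open>v\<close> a word in \<open>R\<close>, both of length exactly \<open>k\<close>. The shorter of two
  words can be padded by cancelling pairs, so that equality of the lengths matters only modulo 2:
  the vertices joined to \<open>x\<close> are precisely the elements \<open>u x v\<close> with \<open>u\<close> and \<open>v\<close> of the same
  length parity (\<open>joined_iff_translate\<close>).

  Call \<open>u x v\<close> an even or an odd translate of \<open>x\<close> according to the parity of the total length.
  Every \<open>x\<close> is an even translate of itself, being a translate of given parity is symmetric, and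
  parities add up along chains of translates. The set
  \<open>\<langle>L\<rangle>\<langle>R\<rangle>\<close> consists of the even and the odd translates of \<open>e\<close>, and the second half of condition
  \<open>(*)\<close> says that \<open>e\<close> is an odd translate of itself, in which case every odd translate is also an
  even one. Any \<open>l \<in> L\<close> is an odd translate of \<open>e\<close>, so if \<open>l\<close> is joined to \<open>e\<close> then \<open>e\<close> is an
  odd translate of itself. This gives the criterion for connectedness. If \<open>G = \<langle>L\<rangle>\<langle>R\<rangle>\<close> but
  \<open>(*)\<close> fails, the even and the odd translates of \<open>e\<close> are disjoint and cover \<open>G\<close>; they are the
  components of \<open>e\<close> and of \<open>l\<close>.
\<close>

section \<open>Components of symmetric digraphs\<close>

lemma strongly_connected_imp_connected_digraph:
  "strongly_connected H \<Longrightarrow> Digraph_Component.connected H"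
  unfolding strongly_connected_def connected_conv reachable_def
  by (auto simp: symcl_def intro: rtrancl_on_mono)

lemma arc_mono_connected: "arc_mono Digraph_Component.connected"
  unfolding arc_mono_def
  by (metis spanning_def subgraphE wf_digraph.connected_spanning_imp_connected)

lemma (in sym_digraph) induced_connected_iff_strongly_connected:
  assumes "induced_subgraph H G"
  shows "Digraph_Component.connected H \<longleftrightarrow> strongly_connected H"
  using induced_graph_imp_graph[OF assms] strongly_connected_imp_connected_digraph
    wf_digraph.symmetric_connected_imp_strongly_connected
  by (auto simp: sym_digraph_def sym_digraph_axioms_def)

text \<open>A connected subgraph of a symmetric digraph need not be symmetric, so connectedness and
  strong connectedness may differ on subgraphs. They agree on induced ones, and a maximal subgraph with
  either property is induced because adding arcs between its vertices preserves both.\<close>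

lemma (in sym_digraph) connected_components_eq_sccs: "connected_components G = sccs"
proof (intro Set.set_eqI iffI)
  fix H assume "H \<in> connected_components G"
  then have max: "max_subgraph Digraph_Component.connected H"
    by (simp add: connected_components_def)
  then have "induced_subgraph H G"
    using arc_mono_connected by (rule induced_subgraphI_arc_mono)
  then have "strongly_connected H"
    using induced_connected_iff_strongly_connected max_subgraph_prop[OF max] by blast
  then show "H \<in> sccs"
    using max_subgraph_mp[OF max strongly_connected_imp_connected_digraph]
    by (simp add: sccs_altdef2)
next
  fix H assume H: "H \<in> sccs"
  then have ind: "induced_subgraph H G" and sc: "strongly_connected H"
    and max: "max_subgraph strongly_connected H"
    using sccs_altdef2 by (auto elim: in_sccsE)
  have "\<not> Digraph_Component.connected K"
    if neq: "H \<noteq> K" and sub: "subgraph H K" "subgraph K G" for K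
  proof
    assume con: "Digraph_Component.connected K"
    let ?K = "G \<restriction> verts K"
    have indK: "induced_subgraph ?K G"
      using sub(2) by (intro induced_induce) auto
    have "subgraph K ?K"
      using sub(2) by (rule subgraph_induce_subgraphI2)
    with con arc_mono_connected have "Digraph_Component.connected ?K"
      unfolding arc_mono_def by (metis induce_subgraph_verts)
    then have "strongly_connected ?K"
      using induced_connected_iff_strongly_connected indK by blast
    moreover have "subgraph H ?K"
      using sub(1) \<open>subgraph K ?K\<close> by (rule subgraph_trans)
    ultimately have "H = ?K"
      using max indK unfolding max_subgraph_def by (metis induced_imp_subgraph)
    with \<open>subgraph K ?K\<close> sub(1) neq show False
      by (auto simp: subgraph_def compatible_def)
  qed
  then show "H \<in> connected_components G"
    using ind strongly_connected_imp_connected_digraph[OF sc]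
    by (auto simp: connected_components_def intro!: max_subgraphI)
qed

section \<open>Words\<close>

lemma word_eval_Nil [simp]: "word_eval G [] = \<one>\<^bsub>G\<^esub>"
  and word_eval_Cons [simp]: "word_eval G (x # w) = x \<otimes>\<^bsub>G\<^esub> word_eval G w"
  by (simp_all add: word_eval_def)

context group
begin

lemma word_eval_closed: "w \<in> lists X \<Longrightarrow> X \<subseteq> carrier G \<Longrightarrow> word_eval G w \<in> carrier G"
  by (induction w) auto

lemma word_eval_append:
  "\<lbrakk>u \<in> lists X; v \<in> lists X; X \<subseteq> carrier G\<rbrakk>
    \<Longrightarrow> word_eval G (u @ v) = word_eval G u \<otimes> word_eval G v"
  by (induction u) (auto simp: word_eval_closed[of _ X] m_assoc subset_iff simp del: in_lists_conv_set)

lemma inv_mem_of_set_inv_eq: "set_inv X = X \<Longrightarrow> x \<in> X \<Longrightarrow> inv x \<in> X"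
  by (auto simp: SET_INV_def)

lemma word_eval_inverse:
  assumes "X \<subseteq> carrier G" "set_inv X = X" "w \<in> lists X"
  obtains w' where "w' \<in> lists X" "length w' = length w" "word_eval G w' = inv (word_eval G w)"
proof -
  have "\<exists>w'\<in>lists X. length w' = length w \<and> word_eval G w' = inv (word_eval G w)"
    using assms(3)
  proof (induction w)
    case (Cons x w)
    then obtain w' where w': "w' \<in> lists X" "length w' = length w"
      "word_eval G w' = inv (word_eval G w)"
      by auto
    have x: "x \<in> carrier G" "inv x \<in> X"
      using Cons assms inv_mem_of_set_inv_eq by auto
    have "word_eval G (w' @ [inv x]) = inv (word_eval G (x # w))"
      using w' x Cons.hyps assms(1)
      by (subst word_eval_append[where X = X]) (auto simp: inv_mult_group word_eval_closed)
    with w' x show ?case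
      by (intro bexI[of _ "w' @ [inv x]"]) auto
  qed auto
  then show thesis using that by blast
qed

lemma generate_eq_word_evals:
  assumes "X \<subseteq> carrier G" "set_inv X = X"
  shows "generate G X = word_eval G ` lists X"
proof (intro Set.set_eqI iffI)
  fix g assume "g \<in> generate G X"
  then show "g \<in> word_eval G ` lists X"
  proof (induction rule: generate.induct)
    case one
    show ?case by (intro image_eqI[of _ _ "[]"]) auto
  next
    case (incl h)
    then show ?case using assms(1) by (intro image_eqI[of _ _ "[h]"]) auto
  next
    case (inv h)
    then show ?case
      using assms inv_mem_of_set_inv_eq by (intro image_eqI[of _ _ "[inv h]"]) auto
  next
    case (eng h1 h2)
    then obtain u v where "u \<in> lists X" "v \<in> lists X" "h1 = word_eval G u" "h2 = word_eval G v"
      by blast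
    then show ?case
      using assms(1) by (intro image_eqI[of _ _ "u @ v"]) (auto simp: word_eval_append)
  qed
next
  fix g assume "g \<in> word_eval G ` lists X"
  then obtain w where "g = word_eval G w" "w \<in> lists X" by blast
  then show "g \<in> generate G X"
    by (induction w arbitrary: g) (auto intro: generate.one generate.incl generate.eng)
qed

end

section \<open>Even and odd translates\<close>

locale inverse_closed_pair = group G for G (structure) +
  fixes L R :: "'a set"
  assumes L_subset: "L \<subseteq> carrier G" and R_subset: "R \<subseteq> carrier G"
    and L_inv: "set_inv L = L" and R_inv: "set_inv R = R"
    and L_nonempty: "L \<noteq> {}" and R_nonempty: "R \<noteq> {}"
begin

text \<open>The parity is the truth value of ``the total length is even'', so that parities are added
  by the equality of Booleans.\<close>

definition translates :: "bool \<Rightarrow> 'a \<Rightarrow> 'a set" where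
  "translates p x = {word_eval G u \<otimes> x \<otimes> word_eval G v | u v.
     u \<in> lists L \<and> v \<in> lists R \<and> even (length u + length v) = p}"

lemma translatesI:
  "\<lbrakk>u \<in> lists L; v \<in> lists R; even (length u + length v) = p; y = word_eval G u \<otimes> x \<otimes> word_eval G v\<rbrakk>
    \<Longrightarrow> y \<in> translates p x"
  unfolding translates_def by blast

lemma translatesE:
  assumes "y \<in> translates p x"
  obtains u v where "u \<in> lists L" "v \<in> lists R" "even (length u + length v) = p"
    "y = word_eval G u \<otimes> x \<otimes> word_eval G v"
    "word_eval G u \<in> carrier G" "word_eval G v \<in> carrier G"
  using assms L_subset R_subset word_eval_closed unfolding translates_def by blast

lemma translates_closed: "x \<in> carrier G \<Longrightarrow> y \<in> translates p x \<Longrightarrow> y \<in> carrier G"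
  by (elim translatesE) auto

lemma translates_refl: "x \<in> carrier G \<Longrightarrow> x \<in> translates True x"
  by (rule translatesI[of "[]" "[]"]) auto

lemma translates_trans:
  assumes "x \<in> carrier G" "y \<in> translates p x" "z \<in> translates q y"
  shows "z \<in> translates (p = q) x"
proof -
  obtain u v where uv: "u \<in> lists L" "v \<in> lists R" "even (length u + length v) = p"
    "y = word_eval G u \<otimes> x \<otimes> word_eval G v"
    "word_eval G u \<in> carrier G" "word_eval G v \<in> carrier G"
    using assms(2) by (rule translatesE)
  obtain u' v' where uv': "u' \<in> lists L" "v' \<in> lists R" "even (length u' + length v') = q"
    "z = word_eval G u' \<otimes> y \<otimes> word_eval G v'"
    "word_eval G u' \<in> carrier G" "word_eval G v' \<in> carrier G"
    using assms(3) by (rule translatesE)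
  show ?thesis
  proof (rule translatesI[of "u' @ u" "v @ v'"])
    show "z = word_eval G (u' @ u) \<otimes> x \<otimes> word_eval G (v @ v')"
      using uv uv' assms(1) L_subset R_subset
      by (simp add: word_eval_append[of _ L] word_eval_append[of _ R] m_assoc)
  qed (use uv uv' in auto)
qed

lemma translates_sym:
  assumes "x \<in> carrier G" "y \<in> translates p x"
  shows "x \<in> translates p y"
proof -
  obtain u v where uv: "u \<in> lists L" "v \<in> lists R" "even (length u + length v) = p"
    "y = word_eval G u \<otimes> x \<otimes> word_eval G v"
    "word_eval G u \<in> carrier G" "word_eval G v \<in> carrier G"
    using assms(2) by (rule translatesE)
  obtain u' where u': "u' \<in> lists L" "length u' = length u" "word_eval G u' = inv (word_eval G u)"
    using word_eval_inverse[OF L_subset L_inv uv(1)] by blast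
  obtain v' where v': "v' \<in> lists R" "length v' = length v" "word_eval G v' = inv (word_eval G v)"
    using word_eval_inverse[OF R_subset R_inv uv(2)] by blast
  have "x = inv (word_eval G u) \<otimes> (word_eval G u \<otimes> x \<otimes> word_eval G v) \<otimes> inv (word_eval G v)"
    using uv(5,6) assms(1) by (simp add: m_assoc inv_solve_left)
  with uv u' v' show ?thesis
    by (intro translatesI[of u' v']) auto
qed

lemma odd_translate_one_of_mem_L: "l \<in> L \<Longrightarrow> l \<in> translates False \<one>"
  using L_subset by (intro translatesI[of "[l]" "[]"]) auto

lemma translates_one_iff:
  "y \<in> translates p \<one> \<longleftrightarrow>
     (\<exists>u\<in>lists L. \<exists>v\<in>lists R. even (length u + length v) = p \<and>
        y = word_eval G u \<otimes> word_eval G v)"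
proof -
  have "word_eval G u \<otimes> \<one> = word_eval G u" if "u \<in> lists L" for u
    using word_eval_closed[OF that L_subset] by simp
  then show ?thesis
    unfolding translates_def mem_Collect_eq by metis
qed

lemma generate_mult_generate_eq_translates:
  "generate G L <#> generate G R = translates True \<one> \<union> translates False \<one>"
  unfolding generate_eq_word_evals[OF L_subset L_inv] generate_eq_word_evals[OF R_subset R_inv]
    set_mult_def
  by (rule Set.set_eqI) (simp add: translates_one_iff image_def del: in_lists_conv_set, blast)

text \<open>The words \<open>w\<close> and \<open>w'\<close> of condition \<open>(*)\<close> exhibit \<open>\<one> = w \<one> w'\<close> with odd total length.\<close>

lemma condition_star_iff_odd_translate:
  "condition_star G L R \<longleftrightarrow>
     carrier G = generate G L <#> generate G R \<and> \<one> \<in> translates False \<one>"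
proof -
  have "\<one> \<in> translates False \<one> \<longleftrightarrow> (\<exists>u\<in>lists L. \<exists>v\<in>lists R.
      even (length u) \<noteq> even (length v) \<and> word_eval G u \<otimes> word_eval G v = \<one>)"
    unfolding translates_one_iff even_add by metis
  then show ?thesis
    unfolding condition_star_def by simp
qed

section \<open>Reachability in the two-sided Cayley graph\<close>

lemma arcs_ends_two_S_Cay:
  "(x, y) \<in> arcs_ends (two_S_Cay G L R) \<longleftrightarrow>
     x \<in> carrier G \<and> (\<exists>l\<in>L. \<exists>r\<in>R. y = l \<otimes> x \<otimes> r)"
proof -
  have "inv l \<in> L \<and> inv (inv l) = l \<and> l \<in> carrier G" if "l \<in> L" for l
    using that L_subset inv_mem_of_set_inv_eq[OF L_inv] by auto
  moreover have "r \<in> carrier G" if "r \<in> R" for r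
    using that R_subset by auto
  ultimately show ?thesis
    unfolding two_S_Cay_def by (auto; metis m_closed)
qed

lemma verts_two_S_Cay: "verts (two_S_Cay G L R) = carrier G"
  by (simp add: two_S_Cay_def)

lemma sym_digraph_two_S_Cay: "sym_digraph (two_S_Cay G L R)"
proof
  show "tail (two_S_Cay G L R) e \<in> verts (two_S_Cay G L R)"
    and "head (two_S_Cay G L R) e \<in> verts (two_S_Cay G L R)"
    if "e \<in> arcs (two_S_Cay G L R)" for e
    using that by (auto simp: two_S_Cay_def)
  have "(y, x) \<in> arcs_ends (two_S_Cay G L R)" if xy: "(x, y) \<in> arcs_ends (two_S_Cay G L R)" for x y
  proof -
    obtain l r where lr: "x \<in> carrier G" "l \<in> L" "r \<in> R" "y = l \<otimes> x \<otimes> r"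
      using xy by (auto simp: arcs_ends_two_S_Cay)
    then have c: "l \<in> carrier G" "r \<in> carrier G" "inv l \<in> L" "inv r \<in> R"
      using L_subset R_subset inv_mem_of_set_inv_eq L_inv R_inv by auto
    then have "x = inv l \<otimes> y \<otimes> inv r"
      using lr by (simp add: m_assoc inv_solve_left)
    moreover have "y \<in> carrier G"
      using lr c by simp
    ultimately show ?thesis
      unfolding arcs_ends_two_S_Cay using c by blast
  qed
  then show "symmetric (two_S_Cay G L R)"
    by (auto simp: symmetric_def intro: symI)
qed

end

sublocale inverse_closed_pair \<subseteq> Cay: sym_digraph "two_S_Cay G L R"
  by (rule sym_digraph_two_S_Cay)

context inverse_closed_pair
begin

abbreviation joined :: "'a \<Rightarrow> 'a \<Rightarrow> bool" (infix "\<leadsto>" 50) where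
  "x \<leadsto> y \<equiv> reachable (two_S_Cay G L R) x y"

lemma joined_arc: "\<lbrakk>x \<in> carrier G; l \<in> L; r \<in> R\<rbrakk> \<Longrightarrow> x \<leadsto> l \<otimes> x \<otimes> r"
  using Cay.reachable_adjI arcs_ends_two_S_Cay by blast

text \<open>Multiplication by two letters on one side alone takes two arcs: on the other side these
  multiply by some letter and then by its inverse, and inverse-closedness provides the latter.\<close>

lemma joined_mult_two_right:
  assumes "x \<in> carrier G" "r1 \<in> R" "r2 \<in> R"
  shows "x \<leadsto> x \<otimes> (r1 \<otimes> r2)"
proof -
  obtain l where l: "l \<in> L" "inv l \<in> L"
    using L_nonempty inv_mem_of_set_inv_eq[OF L_inv] by (metis ex_in_conv)
  have c: "l \<in> carrier G" "r1 \<in> carrier G" "r2 \<in> carrier G"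
    using l assms L_subset R_subset by blast+
  have "inv l \<otimes> (l \<otimes> x \<otimes> r1) \<otimes> r2 = (inv l \<otimes> l) \<otimes> x \<otimes> (r1 \<otimes> r2)"
    using c assms(1) by (simp only: m_assoc m_closed inv_closed)
  moreover have "x \<leadsto> inv l \<otimes> (l \<otimes> x \<otimes> r1) \<otimes> r2"
    using c assms l
    by (intro Cay.reachable_trans[OF joined_arc[of x l r1] joined_arc[of _ "inv l" r2]]) auto
  ultimately show ?thesis using c assms(1) by simp
qed

lemma joined_mult_two_left:
  assumes "x \<in> carrier G" "l1 \<in> L" "l2 \<in> L"
  shows "x \<leadsto> l1 \<otimes> l2 \<otimes> x"
proof -
  obtain r where r: "r \<in> R" "inv r \<in> R"
    using R_nonempty inv_mem_of_set_inv_eq[OF R_inv] by (metis ex_in_conv)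
  have c: "r \<in> carrier G" "l1 \<in> carrier G" "l2 \<in> carrier G"
    using r assms L_subset R_subset by blast+
  have "l1 \<otimes> (l2 \<otimes> x \<otimes> r) \<otimes> inv r = (l1 \<otimes> l2) \<otimes> x \<otimes> (r \<otimes> inv r)"
    using c assms(1) by (simp only: m_assoc m_closed inv_closed)
  moreover have "x \<leadsto> l1 \<otimes> (l2 \<otimes> x \<otimes> r) \<otimes> inv r"
    using c assms r
    by (intro Cay.reachable_trans[OF joined_arc[of x l2 r] joined_arc[of _ l1 "inv r"]]) auto
  ultimately show ?thesis using c assms(1) by simp
qed

text \<open>The letters next to \<open>x\<close> are consumed one from each side while both words last; once one word
  is used up, the other has even length and goes two letters at a time.\<close>

lemma joined_word_translate:
  assumes "x \<in> carrier G" "u \<in> lists L" "v \<in> lists R" "even (length u + length v)"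
  shows "x \<leadsto> word_eval G u \<otimes> x \<otimes> word_eval G v"
  using assms
proof (induction "length u + length v" arbitrary: x u v rule: less_induct)
  case less
  have c: "\<And>l. l \<in> L \<Longrightarrow> l \<in> carrier G" "\<And>r. r \<in> R \<Longrightarrow> r \<in> carrier G"
    using L_subset R_subset by blast+
  note words = word_eval_closed[OF _ L_subset] word_eval_closed[OF _ R_subset]
    word_eval_append[OF _ _ L_subset]
  have via: ?case
    if "y \<in> carrier G" "x \<leadsto> y" "u' \<in> lists L" "v' \<in> lists R"
      "length u' + length v' < length u + length v" "even (length u' + length v')"
      "word_eval G u' \<otimes> y \<otimes> word_eval G v' = word_eval G u \<otimes> x \<otimes> word_eval G v" for y u' v'
    using Cay.reachable_trans[OF \<open>x \<leadsto> y\<close> less.hyps[OF that(5,1,3,4,6)]] that(7) by simp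
  show ?case
  proof (cases u rule: rev_cases)
    case u: Nil
    show ?thesis
    proof (cases v)
      case Nil
      with u less.prems show ?thesis by (simp add: verts_two_S_Cay)
    next
      case v: (Cons r1 v1)
      with u less.prems obtain r2 v2 where v1: "v1 = r2 # v2"
        by (cases v1) auto
      show ?thesis
      proof (rule via[of "x \<otimes> (r1 \<otimes> r2)" "[]" v2])
        show "x \<leadsto> x \<otimes> (r1 \<otimes> r2)"
          using less.prems v v1 by (intro joined_mult_two_right) auto
      qed (use less.prems u v v1 c words in \<open>auto simp: m_assoc\<close>)
    qed
  next
    case u: (snoc u1 l1)
    show ?thesis
    proof (cases v)
      case v: Nil
      with u less.prems obtain u2 l2 where u1: "u1 = u2 @ [l2]"
        by (cases u1 rule: rev_cases) auto
      show ?thesis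
      proof (rule via[of "l2 \<otimes> l1 \<otimes> x" u2 "[]"])
        show "x \<leadsto> l2 \<otimes> l1 \<otimes> x"
          using less.prems u u1 by (intro joined_mult_two_left) auto
      qed (use less.prems u v u1 c words in \<open>auto simp: m_assoc\<close>)
    next
      case v: (Cons r1 v1)
      show ?thesis
      proof (rule via[of "l1 \<otimes> x \<otimes> r1" u1 v1])
        show "x \<leadsto> l1 \<otimes> x \<otimes> r1"
          using less.prems u v by (intro joined_arc) auto
      qed (use less.prems u v c words in \<open>auto simp: m_assoc\<close>)
    qed
  qed
qed

lemma joined_iff_translate:
  assumes x: "x \<in> carrier G"
  shows "x \<leadsto> y \<longleftrightarrow> y \<in> translates True x"
proof
  assume "x \<leadsto> y"
  then show "y \<in> translates True x"
  proof (induction rule: Cay.reachable_induct)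
    case base
    show ?case using x by (rule translates_refl)
  next
    case (step y z)
    then obtain l r where "l \<in> L" "r \<in> R" "z = l \<otimes> y \<otimes> r"
      by (auto simp: arcs_ends_two_S_Cay)
    then have "z \<in> translates True y"
      using L_subset R_subset translates_closed[OF x step.IH]
      by (intro translatesI[of "[l]" "[r]"]) (auto simp: subset_iff)
    with translates_trans[OF x step.IH] show ?case by simp
  qed
next
  assume "y \<in> translates True x"
  with x show "x \<leadsto> y"
    by (elim translatesE) (simp add: joined_word_translate)
qed

lemma connected_iff_even_translates:
  "Digraph_Component.connected (two_S_Cay G L R) \<longleftrightarrow> carrier G \<subseteq> translates True \<one>"
proof -
  have "Digraph_Component.connected (two_S_Cay G L R) \<longleftrightarrow> strongly_connected (two_S_Cay G L R)"
    using Cay.induced_connected_iff_strongly_connected Cay.induced_subgraph_refl by blast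
  also have "\<dots> \<longleftrightarrow> (\<forall>x\<in>carrier G. \<forall>y\<in>carrier G. y \<in> translates True x)"
    unfolding strongly_connected_def verts_two_S_Cay by (auto simp: joined_iff_translate)
  also have "\<dots> \<longleftrightarrow> carrier G \<subseteq> translates True \<one>"
  proof (intro iffI ballI)
    fix x y assume con: "carrier G \<subseteq> translates True \<one>" and xy: "x \<in> carrier G" "y \<in> carrier G"
    then have "\<one> \<in> translates True x" "y \<in> translates True \<one>"
      using translates_sym[OF one_closed] by blast+
    then show "y \<in> translates True x"
      using translates_trans[OF xy(1)] by fastforce
  qed auto
  finally show ?thesis .
qed

section \<open>Connectedness and the number of components\<close>

lemma connected_iff_condition_star:
  "Digraph_Component.connected (two_S_Cay G L R) \<longleftrightarrow> condition_star G L R"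
proof
  assume "Digraph_Component.connected (two_S_Cay G L R)"
  then have con: "carrier G \<subseteq> translates True \<one>"
    by (simp add: connected_iff_even_translates)
  obtain l where l: "l \<in> L" using L_nonempty by blast
  with con L_subset have "\<one> \<in> translates True l"
    using translates_sym[OF one_closed, of l True] by blast
  then have "\<one> \<in> translates False \<one>"
    using translates_trans[OF one_closed odd_translate_one_of_mem_L[OF l], of \<one> True] by simp
  moreover have "carrier G = translates True \<one> \<union> translates False \<one>"
    using con translates_closed[OF one_closed] by blast
  ultimately show "condition_star G L R"
    by (simp add: condition_star_iff_odd_translate generate_mult_generate_eq_translates)
next
  assume "condition_star G L R"
  then have "carrier G = translates True \<one> \<union> translates False \<one>" "\<one> \<in> translates False \<one>"
    by (simp_all add: condition_star_iff_odd_translate generate_mult_generate_eq_translates)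
  moreover from this(2) have "translates False \<one> \<subseteq> translates True \<one>"
    using translates_trans[OF one_closed, of \<one> False _ False] by fastforce
  ultimately show "Digraph_Component.connected (two_S_Cay G L R)"
    by (simp add: connected_iff_even_translates)
qed

text \<open>The component of \<open>x\<close> consists of its even translates. An odd translate of \<open>\<one>\<close> is an even
  translate of \<open>l\<close>, so the components of \<open>\<one>\<close> and of \<open>l\<close> are the only ones; if they coincided,
  \<open>\<one>\<close> would be an odd translate of itself.\<close>

lemma card_connected_components_eq_2:
  assumes G: "carrier G = generate G L <#> generate G R" and not_star: "\<not> condition_star G L R"
  shows "card (connected_components (two_S_Cay G L R)) = 2"
proof -
  have scc: "Cay.scc_of x = translates True x" if "x \<in> carrier G" for x
    using that joined_iff_translate Cay.symmetric_reachable'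
    unfolding Cay.scc_of_def by blast
  obtain l where l: "l \<in> L" using L_nonempty by blast
  then have odd_l: "l \<in> translates False \<one>" and lG: "l \<in> carrier G"
    using odd_translate_one_of_mem_L L_subset by auto
  have "Cay.scc_of x \<in> {Cay.scc_of \<one>, Cay.scc_of l}" if x: "x \<in> carrier G" for x
  proof -
    consider "x \<in> translates True \<one>" | "x \<in> translates False \<one>"
      using x G generate_mult_generate_eq_translates by blast
    then show ?thesis
    proof cases
      case 1
      then show ?thesis using Cay.scc_of_eq scc one_closed by blast
    next
      case 2
      then have "x \<in> translates True l"
        using translates_trans[OF lG translates_sym[OF one_closed odd_l]] by fastforce
      then show ?thesis using Cay.scc_of_eq scc lG by blast
    qed
  qed
  then have "Cay.sccs_verts = {Cay.scc_of \<one>, Cay.scc_of l}"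
    unfolding Cay.sccs_verts_conv_scc_of verts_two_S_Cay using lG one_closed by blast
  moreover have "Cay.scc_of \<one> \<noteq> Cay.scc_of l"
  proof
    assume "Cay.scc_of \<one> = Cay.scc_of l"
    then have "\<one> \<in> translates True l"
      using scc lG translates_refl by blast
    then have "\<one> \<in> translates False \<one>"
      using translates_trans[OF one_closed odd_l] by fastforce
    with G not_star show False
      by (simp add: condition_star_iff_odd_translate)
  qed
  ultimately show ?thesis
    using Cay.card_sccs_verts Cay.connected_components_eq_sccs by simp
qed

end

theorem theorem1p5:
  fixes G :: "('a, 'b) monoid_scheme" and L R :: "'a set"
  assumes "group G"
    and "L \<subseteq> carrier G" and "R \<subseteq> carrier G"
    and "set_inv\<^bsub>G\<^esub> L = L" and "set_inv\<^bsub>G\<^esub> R = R"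
    and "two_S_Cayley_property G L R"
  defines "\<Gamma> \<equiv> two_S_Cay G L R"
  shows "(Digraph_Component.connected \<Gamma> \<longleftrightarrow> condition_star G L R) \<and>
    (carrier G = generate G L <#>\<^bsub>G\<^esub> generate G R \<and> \<not> condition_star G L R \<longrightarrow>
       \<not> Digraph_Component.connected \<Gamma> \<and> card (connected_components \<Gamma>) = 2)"
proof -
  have "L \<noteq> {}" "R \<noteq> {}"
    using assms(6) by (auto simp: two_S_Cayley_property_def)
  then interpret inverse_closed_pair G L R
    using assms by (simp add: inverse_closed_pair_def inverse_closed_pair_axioms_def)
  show ?thesis
    unfolding \<Gamma>_def using connected_iff_condition_star card_connected_components_eq_2 by blast
qed

end
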